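(* If $\sigma>0.25$, then the three-level explicit-implicit scheme $$\frac{y^{n+1}-y^{n-1}}{2\tau}+D(\sigma y^{n+1}+(1-2\sigma)y^n+\sigma y^{n-1})+C^ny^n=\varphi^n,\quad n=1,2,\dots,N_0-1,\qquad y^0=u^0,\ y^1=u^1,$$ is $\varrho$-stable with $$\varrho=1+M_2\frac{4\sigma}{4\sigma-1}\tau,$$ and its solution satisfies the a priori estimate $$\mathcal E^{n+1}\le\varrho\,\mathcal E^n+\tau\|\varphi^n\|^2,\qquad n=1,\dots,N_0-1,$$ where $$\mathcal E^{n+1}=\frac14\big(D(y^{n+1}+y^n),y^{n+1}+y^n\big)+\Big(\sigma-\frac14\Big)\big(D(y^{n+1}-y^n),y^{n+1}-y^n\big).$$
   Context: $H$ is a finite-dimensional real Hilbert space (of grid functions) with scalar product $(\cdot,\cdot)$ and norm $\|\cdot\|$. $\tau>0$ is the time step, $N_0\tau=T$. $D$ is a time-independent linear operator with $D=D^*\ge\frac{\kappa_1}{M_0}E$, $\kappa_1,M_0>0$, $E$ the identity. $C^n$ is a (possibly time-dependent) linear operator on $H$ satisfying $\|C^ny\|^2\le M_2(Dy,y)$ for all $y\in H$, with a positive constant $M_2$ independent of $n$. $u^0,u^1,\varphi^n\in H$ are given. $\varrho$-stability here means that for $\varphi^n=0$ one has $\mathcal E^{n+1}\le\varrho\,\mathcal E^n$ for all $n$, where $\varrho^n\le m_1$ with a constant $m_1$ independent of $\tau$ and $n$. *)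

theory Defs
  imports "HOL-Analysis.Analysis"
begin

text \<open>
  The sequence \<open>y\<close> is only constrained at the grid levels \<open>0, \<dots>, N0\<close>.
\<close>
definition scheme_solution ::
  "('a::euclidean_space \<Rightarrow> 'a) \<Rightarrow> (nat \<Rightarrow> 'a \<Rightarrow> 'a) \<Rightarrow> real \<Rightarrow> real \<Rightarrow> nat \<Rightarrow>
   'a \<Rightarrow> 'a \<Rightarrow> (nat \<Rightarrow> 'a) \<Rightarrow> (nat \<Rightarrow> 'a) \<Rightarrow> bool" where
  "scheme_solution D C \<sigma> \<tau> N0 u0 u1 \<phi> y \<longleftrightarrow>
     y 0 = u0 \<and> y 1 = u1 \<and>
     (\<forall>n\<in>{1..<N0}.
        (1 / (2 * \<tau>)) *\<^sub>R (y (n + 1) - y (n - 1))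
        + D (\<sigma> *\<^sub>R y (n + 1) + (1 - 2 * \<sigma>) *\<^sub>R y n + \<sigma> *\<^sub>R y (n - 1))
        + C n (y n) = \<phi> n)"

text \<open>\<open>energy D \<sigma> y n\<close> is meaningful for \<open>n \<ge> 1\<close> only, because of the truncated \<open>n - 1\<close>.\<close>
definition energy ::
  "('a::euclidean_space \<Rightarrow> 'a) \<Rightarrow> real \<Rightarrow> (nat \<Rightarrow> 'a) \<Rightarrow> nat \<Rightarrow> real" where
  "energy D \<sigma> y n =
     1 / 4 * (D (y n + y (n - 1)) \<bullet> (y n + y (n - 1)))
     + (\<sigma> - 1 / 4) * (D (y n - y (n - 1)) \<bullet> (y n - y (n - 1)))"

text \<open>
  Stability is a property of the family of schemes obtained from all time steps \<open>\<tau>\<close> with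
  \<open>N0 \<tau> = T\<close>: both the operators \<open>C \<tau> n\<close> and the factor \<open>\<rho> \<tau>\<close> may depend on
  \<open>\<tau>\<close>, while the bound \<open>m1\<close> on the powers of \<open>\<rho> \<tau>\<close> depends neither on \<open>\<tau>\<close> nor on \<open>n\<close>.
\<close>
definition rho_stable ::
  "real \<Rightarrow> ('a::euclidean_space \<Rightarrow> 'a) \<Rightarrow> (real \<Rightarrow> nat \<Rightarrow> 'a \<Rightarrow> 'a) \<Rightarrow> real \<Rightarrow>
   (real \<Rightarrow> real) \<Rightarrow> bool" where
  "rho_stable T D C \<sigma> \<rho> \<longleftrightarrow>
     (\<forall>\<tau> N0 u0 u1 y. \<tau> > 0 \<and> real N0 * \<tau> = T \<and>
        scheme_solution D (C \<tau>) \<sigma> \<tau> N0 u0 u1 (\<lambda>n. 0) y \<longrightarrow>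
        (\<forall>n\<in>{1..<N0}. energy D \<sigma> y (n + 1) \<le> \<rho> \<tau> * energy D \<sigma> y n)) \<and>
     (\<exists>m1. \<forall>\<tau> N0 n. \<tau> > 0 \<and> real N0 * \<tau> = T \<and> n \<le> N0 \<longrightarrow> \<rho> \<tau> ^ n \<le> m1)"

end

theory Submission
  imports Defs
begin

text \<open>
  With \<open>a = y\<^sup>n\<^sup>+\<^sup>1 + y\<^sup>n\<close>, \<open>b = y\<^sup>n + y\<^sup>n\<^sup>-\<^sup>1\<close>, \<open>p = y\<^sup>n\<^sup>+\<^sup>1 - y\<^sup>n\<close>, \<open>q = y\<^sup>n - y\<^sup>n\<^sup>-\<^sup>1\<close>, the implicit average equals
  \<open>(a + b) / 4 + (\<sigma> - 1/4) (p - q)\<close>, while \<open>y\<^sup>n\<^sup>+\<^sup>1 - y\<^sup>n\<^sup>-\<^sup>1 = a - b = p + q\<close>. Testing the scheme with this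
  difference therefore turns the \<open>D\<close>-term into the exact energy increment. The right-hand side is
  absorbed by the term \<open>\<parallel>y\<^sup>n\<^sup>+\<^sup>1 - y\<^sup>n\<^sup>-\<^sup>1\<parallel>\<^sup>2 / (2\<tau>)\<close> up to \<open>\<tau> (\<parallel>\<phi>\<^sup>n\<parallel>\<^sup>2 + M2 (D y\<^sup>n, y\<^sup>n))\<close>, and since
  \<open>y\<^sup>n = (b + q) / 2\<close>, Young's inequality in the \<open>D\<close>-norm bounds \<open>(D y\<^sup>n, y\<^sup>n)\<close> by
  \<open>4\<sigma> / (4\<sigma> - 1)\<close> times the energy.
\<close>

lemma energy_increment:
  fixes D :: "'a::euclidean_space \<Rightarrow> 'a"
  assumes "linear D" and sym: "\<And>x z. D x \<bullet> z = D z \<bullet> x" and "n \<ge> 1"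
  shows "D (\<sigma> *\<^sub>R y (n + 1) + (1 - 2 * \<sigma>) *\<^sub>R y n + \<sigma> *\<^sub>R y (n - 1)) \<bullet> (y (n + 1) - y (n - 1)) =
    energy D \<sigma> y (n + 1) - energy D \<sigma> y n"
  \<comment> \<open>Symmetry for the three pairs of levels merges the mixed products; what remains
    is a polynomial identity.\<close>
  using sym[of "y n" "y (n + 1)"] sym[of "y n" "y (n - 1)"] sym[of "y (n + 1)" "y (n - 1)"]
  by (simp add: energy_def linear_add[OF assms(1)] linear_diff[OF assms(1)]
      linear_scale[OF assms(1)] inner_add inner_diff algebra_simps)

lemma quadratic_form_le_energy:
  fixes D :: "'a::euclidean_space \<Rightarrow> 'a"
  assumes "linear D" and sym: "\<And>x z. D x \<bullet> z = D z \<bullet> x" and nonneg: "\<And>x. 0 \<le> D x \<bullet> x"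
    and "\<sigma> > 1 / 4"
  shows "D (y n) \<bullet> y n \<le> 4 * \<sigma> / (4 * \<sigma> - 1) * energy D \<sigma> y n"
proof -
  define s where "s = 4 * \<sigma> - 1"
  have s: "s > 0" and \<sigma>: "\<sigma> = (s + 1) / 4"
    using assms(4) by (auto simp: s_def)
  let ?b = "y n + y (n - 1)" and ?q = "y n - y (n - 1)"
  \<comment> \<open>The weight \<open>s\<close> is the ratio of the \<open>?q\<close>- and
    \<open>?b\<close>-coefficients in the energy; it makes the bound sharp, with equality for
    \<open>?b = s *\<^sub>R ?q\<close>.\<close>
  have "0 \<le> D (?b - s *\<^sub>R ?q) \<bullet> (?b - s *\<^sub>R ?q)"
    by (rule nonneg)
  also have "\<dots> = 4 * ((s + 1) * energy D \<sigma> y n - s * (D (y n) \<bullet> y n))"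
    using sym[of "y n" "y (n - 1)"] unfolding \<sigma>
    by (simp add: energy_def linear_add[OF assms(1)] linear_diff[OF assms(1)]
        linear_scale[OF assms(1)] inner_add inner_diff field_simps)
  finally have "s * (D (y n) \<bullet> y n) \<le> (s + 1) * energy D \<sigma> y n"
    by simp
  then have "D (y n) \<bullet> y n \<le> (s + 1) / s * energy D \<sigma> y n"
    using s by (simp add: field_simps)
  then show ?thesis
    by (simp add: s_def)
qed

lemma inner_diff_le_young:
  fixes f g d :: "'a::real_inner"
  assumes "\<tau> > 0"
  shows "(f - g) \<bullet> d \<le> (d \<bullet> d) / (2 * \<tau>) + \<tau> * ((norm f)\<^sup>2 + (norm g)\<^sup>2)"
proof -
  \<comment> \<open>The first square gives Young's inequality for \<open>f - g\<close> and
    \<open>d\<close>; the second is the parallelogram defect that splits \<open>f - g\<close> into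
    \<open>f\<close> and \<open>g\<close>.\<close>
  have "0 \<le> (norm (d - \<tau> *\<^sub>R (f - g)))\<^sup>2 + \<tau>\<^sup>2 * (norm (f + g))\<^sup>2"
    by simp
  also have "\<dots> = 2 * \<tau> * ((d \<bullet> d) / (2 * \<tau>) + \<tau> * ((norm f)\<^sup>2 + (norm g)\<^sup>2) - (f - g) \<bullet> d)"
    using assms unfolding power2_norm_eq_inner
    by (simp add: inner_add inner_diff inner_commute power2_eq_square algebra_simps)
  finally show ?thesis
    using assms by (simp add: zero_le_mult_iff)
qed

lemma energy_step:
  fixes D :: "'a::euclidean_space \<Rightarrow> 'a"
  assumes "linear D" and sym: "\<And>x z. D x \<bullet> z = D z \<bullet> x" and nonneg: "\<And>x. 0 \<le> D x \<bullet> x"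
    and "\<sigma> > 1 / 4" and "\<tau> > 0" and "M2 > 0"
    and C: "(norm (C n (y n)))\<^sup>2 \<le> M2 * (D (y n) \<bullet> y n)"
    and sol: "scheme_solution D C \<sigma> \<tau> N0 u0 u1 \<phi> y" and n: "n \<in> {1..<N0}"
  shows "energy D \<sigma> y (n + 1) \<le>
    (1 + M2 * (4 * \<sigma> / (4 * \<sigma> - 1)) * \<tau>) * energy D \<sigma> y n + \<tau> * (norm (\<phi> n))\<^sup>2"
proof -
  let ?d = "y (n + 1) - y (n - 1)" and ?K = "4 * \<sigma> / (4 * \<sigma> - 1)"
  let ?m = "\<sigma> *\<^sub>R y (n + 1) + (1 - 2 * \<sigma>) *\<^sub>R y n + \<sigma> *\<^sub>R y (n - 1)"
  have "(1 / (2 * \<tau>)) *\<^sub>R ?d + D ?m + C n (y n) = \<phi> n"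
    using sol n unfolding scheme_solution_def by blast
  then have "\<phi> n - C n (y n) = (1 / (2 * \<tau>)) *\<^sub>R ?d + D ?m"
    by (metis add_diff_cancel_right')
  then have "(\<phi> n - C n (y n)) \<bullet> ?d = (?d \<bullet> ?d) / (2 * \<tau>) + D ?m \<bullet> ?d"
    by (simp only: inner_add_left inner_scaleR_left) simp
  also have "D ?m \<bullet> ?d = energy D \<sigma> y (n + 1) - energy D \<sigma> y n"
    using n by (intro energy_increment assms) auto
  \<comment> \<open>Both sides contain \<open>(?d \<bullet> ?d) / (2 * \<tau>)\<close>, which
    cancels exactly.\<close>
  finally have "energy D \<sigma> y (n + 1) - energy D \<sigma> y n \<le>
      \<tau> * ((norm (\<phi> n))\<^sup>2 + (norm (C n (y n)))\<^sup>2)"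
    using inner_diff_le_young[OF \<open>\<tau> > 0\<close>, of "\<phi> n" "C n (y n)" ?d] by linarith
  also have "\<dots> \<le> \<tau> * ((norm (\<phi> n))\<^sup>2 + M2 * (?K * energy D \<sigma> y n))"
  proof -
    have "M2 * (D (y n) \<bullet> y n) \<le> M2 * (?K * energy D \<sigma> y n)"
      using \<open>M2 > 0\<close> by (intro mult_left_mono quadratic_form_le_energy assms) auto
    then show ?thesis
      using C \<open>\<tau> > 0\<close> by (intro mult_left_mono add_left_mono) auto
  qed
  finally show ?thesis
    by (simp only: algebra_simps)
qed

text \<open>Since n \<tau> \<le> T, the growth up to the final time is bounded independently of the
  step size and the level, as \<rho>-stability demands.\<close>

lemma one_plus_power_le_exp:
  fixes c \<tau> T :: real
  assumes "c \<ge> 0" "\<tau> > 0" "real N0 * \<tau> = T" "n \<le> N0"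
  shows "(1 + c * \<tau>) ^ n \<le> exp (c * T)"
proof -
  have "(1 + c * \<tau>) ^ n \<le> exp (c * \<tau>) ^ n"
    using assms by (intro power_mono exp_ge_add_one_self) auto
  also have "\<dots> = exp (c * (real n * \<tau>))"
    by (simp add: exp_of_nat_mult[symmetric] mult_ac)
  also have "\<dots> \<le> exp (c * (real N0 * \<tau>))"
    using assms by (intro exp_mono mult_left_mono mult_right_mono) auto
  finally show ?thesis
    using assms(3) by simp
qed

theorem theorem20:
  fixes D :: "'a::euclidean_space \<Rightarrow> 'a"
    and C :: "real \<Rightarrow> nat \<Rightarrow> 'a \<Rightarrow> 'a"
    and T \<sigma> \<kappa>1 M0 M2 :: real
  assumes "T > 0" "\<kappa>1 > 0" "M0 > 0" "M2 > 0"
    and "linear D" "adjoint D = D"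
    and "\<And>y. \<kappa>1 / M0 * (y \<bullet> y) \<le> D y \<bullet> y"
    and "\<And>\<tau> N0 n. \<tau> > 0 \<Longrightarrow> real N0 * \<tau> = T \<Longrightarrow> n \<in> {1..<N0} \<Longrightarrow> linear (C \<tau> n)"
    and "\<And>\<tau> N0 n y. \<tau> > 0 \<Longrightarrow> real N0 * \<tau> = T \<Longrightarrow> n \<in> {1..<N0} \<Longrightarrow>
           (norm (C \<tau> n y))\<^sup>2 \<le> M2 * (D y \<bullet> y)"
    and "\<sigma> > 1 / 4"
  shows "rho_stable T D C \<sigma> (\<lambda>\<tau>. 1 + M2 * (4 * \<sigma> / (4 * \<sigma> - 1)) * \<tau>) \<and>
    (\<forall>\<tau> N0 u0 u1 \<phi> y. \<tau> > 0 \<and> real N0 * \<tau> = T \<and>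
       scheme_solution D (C \<tau>) \<sigma> \<tau> N0 u0 u1 \<phi> y \<longrightarrow>
       (\<forall>n\<in>{1..<N0}. energy D \<sigma> y (n + 1) \<le>
          (1 + M2 * (4 * \<sigma> / (4 * \<sigma> - 1)) * \<tau>) * energy D \<sigma> y n + \<tau> * (norm (\<phi> n))\<^sup>2))"
proof -
  let ?K = "4 * \<sigma> / (4 * \<sigma> - 1)"
  have sym: "D x \<bullet> z = D z \<bullet> x" for x z
    using adjoint_works[OF assms(5), of x z] assms(6) by (simp add: inner_commute)
  have nonneg: "0 \<le> D x \<bullet> x" for x
  proof -
    have "0 \<le> \<kappa>1 / M0 * (x \<bullet> x)"
      using assms(2,3) by simp
    then show ?thesis
      using assms(7)[of x] by linarith
  qed
  have step: "energy D \<sigma> y (n + 1) \<le> (1 + M2 * ?K * \<tau>) * energy D \<sigma> y n + \<tau> * (norm (\<phi> n))\<^sup>2"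
    if "\<tau> > 0" "real N0 * \<tau> = T" "scheme_solution D (C \<tau>) \<sigma> \<tau> N0 u0 u1 \<phi> y" "n \<in> {1..<N0}"
    for \<tau> N0 u0 u1 \<phi> y n
    using energy_step[OF assms(5) sym nonneg assms(10) that(1) assms(4) assms(9)[OF that(1,2,4)]
        that(3,4)] .
  have "M2 * ?K \<ge> 0"
    using assms(4,10) by simp
  \<comment> \<open>The witness is \<open>exp (M2 * ?K * T)\<close>.\<close>
  then have "\<exists>m1. \<forall>\<tau> N0 n. \<tau> > 0 \<and> real N0 * \<tau> = T \<and> n \<le> N0 \<longrightarrow> (1 + M2 * ?K * \<tau>) ^ n \<le> m1"
    using one_plus_power_le_exp by blast
  moreover have "energy D \<sigma> y (n + 1) \<le> (1 + M2 * ?K * \<tau>) * energy D \<sigma> y n"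
    if "\<tau> > 0" "real N0 * \<tau> = T" "scheme_solution D (C \<tau>) \<sigma> \<tau> N0 u0 u1 (\<lambda>n. 0) y" "n \<in> {1..<N0}"
    for \<tau> N0 u0 u1 y n
    using step[OF that] by simp
  ultimately have "rho_stable T D C \<sigma> (\<lambda>\<tau>. 1 + M2 * ?K * \<tau>)"
    unfolding rho_stable_def by blast
  then show ?thesis
    using step by blast
qed

end
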